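(* Let $G = G_1 \oplus_i G_2$, where $G_1$ and $G_2$ are connected graphs each on at least $2$ vertices, each containing a vertex labeled $i$. Then $\xi\xi(G,i) = \max\{\xi\xi(G_1,i),\ \xi\xi(G_2,i)\}$.
   Context: All graphs are finite and simple. The vertex sum $G_1 \oplus_v G_2$ of graphs $G_1,G_2$ each having a vertex labeled $v$ is obtained by identifying the two vertices labeled $v$, all other vertices remaining distinct. For a graph $G$ on $n$ vertices labeled $1,\dots,n$, $\mathcal{S}(G)$ is the set of $n\times n$ real symmetric matrices whose off-diagonal $(p,q)$-entry is nonzero iff $\{p,q\}\in E(G)$ (diagonal arbitrary). $A(i)$ is $A$ with row and column $i$ deleted; $(AX)(i,:]$ is $AX$ with row $i$ deleted; $\circ$ is the entrywise product. The $i$-nullity pair of $A$ is $(\operatorname{null}(A),\operatorname{null}(A(i)))$. A symmetric $A$ has $i$-SNIP if the only symmetric $X$ with $A\circ X=O$, $I\circ X=O$, $(AX)(i,:]=O$ is $X=O$. For a rooted graph $(G,i)$, $\xi\xi(G,i)$ is the maximum of $k+\ell$ over pairs $(k,\ell)$ with $k\le\ell$ such that some $A\in\mathcal{S}(G)$ with $i$-SNIP has $i$-nullity pair $(k,\ell)$. *)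

theory Defs
  imports "HOL-Analysis.Analysis" "Graph_Theory.Graph_Theory"
begin

text \<open>
  A finite simple graph is a \<open>pair_graph\<close>: a finite vertex set together with a symmetric,
  irreflexive arc relation, so \<open>{p, q}\<close> is an edge iff \<open>(p, q)\<close> is an arc. Vertices are
  elements of a finite label type \<open>'v\<close>, and the vertex set may be any subset of it.

  Two graphs share exactly those vertices that carry the same label. Hence, if \<open>v\<close> is the only
  common label of \<open>G\<^sub>1\<close> and \<open>G\<^sub>2\<close>, identifying the two vertices labeled \<open>v\<close> and keeping all other
  vertices distinct amounts to taking unions.
\<close>

definition vertex_sum :: "'v pair_pre_digraph \<Rightarrow> 'v pair_pre_digraph \<Rightarrow> 'v pair_pre_digraph" where
  "vertex_sum G1 G2 = \<lparr> pverts = pverts G1 \<union> pverts G2, parcs = parcs G1 \<union> parcs G2 \<rparr>"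

text \<open>
  A matrix (vector) whose rows and columns (entries) are indexed by a set \<open>V\<close> of labels is
  represented by its extension by zero to all labels. Deleting rows or columns shrinks the index
  set, so in this representation the deleted entries become zero.
\<close>

definition vecs_on :: "'v set \<Rightarrow> (real ^ 'v::finite) set" where
  "vecs_on V = {x. \<forall>p. p \<notin> V \<longrightarrow> x $ p = 0}"

definition mats_on :: "'v set \<Rightarrow> (real ^ 'v ^ 'v::finite) set" where
  "mats_on V = {A. \<forall>p q. p \<notin> V \<or> q \<notin> V \<longrightarrow> A $ p $ q = 0}"

definition sym_mats_on :: "'v set \<Rightarrow> (real ^ 'v ^ 'v::finite) set" where
  "sym_mats_on V = {A \<in> mats_on V. transpose A = A}"

definition graph_mats :: "'v pair_pre_digraph \<Rightarrow> (real ^ 'v ^ 'v::finite) set" where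
  "graph_mats G = {A \<in> sym_mats_on (pverts G).
     \<forall>p \<in> pverts G. \<forall>q \<in> pverts G. p \<noteq> q \<longrightarrow> (A $ p $ q \<noteq> 0 \<longleftrightarrow> (p, q) \<in> parcs G)}"

definition del_row :: "'v \<Rightarrow> real ^ 'v ^ 'v::finite \<Rightarrow> real ^ 'v ^ 'v" where
  "del_row i A = (\<chi> p q. if p = i then 0 else A $ p $ q)"

definition del_row_col :: "'v \<Rightarrow> real ^ 'v ^ 'v::finite \<Rightarrow> real ^ 'v ^ 'v" where
  "del_row_col i A = (\<chi> p q. if p = i \<or> q = i then 0 else A $ p $ q)"

definition hadamard :: "real ^ 'v ^ 'v::finite \<Rightarrow> real ^ 'v ^ 'v \<Rightarrow> real ^ 'v ^ 'v" where
  "hadamard A B = (\<chi> p q. A $ p $ q * B $ p $ q)"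

definition nullity_on :: "'v set \<Rightarrow> real ^ 'v ^ 'v::finite \<Rightarrow> nat" where
  "nullity_on V A = dim {x \<in> vecs_on V. A *v x = 0}"

definition nullity_pair :: "'v set \<Rightarrow> 'v \<Rightarrow> real ^ 'v ^ 'v::finite \<Rightarrow> nat \<times> nat" where
  "nullity_pair V i A = (nullity_on V A, nullity_on (V - {i}) (del_row_col i A))"

text \<open>
  Since \<open>X\<close> vanishes outside \<open>V\<close>, the full identity \<open>mat 1\<close> can stand for the identity indexed
  by \<open>V\<close>.
\<close>

definition has_SNIP :: "'v set \<Rightarrow> 'v \<Rightarrow> real ^ 'v ^ 'v::finite \<Rightarrow> bool" where
  "has_SNIP V i A \<longleftrightarrow> A \<in> sym_mats_on V \<and>
     (\<forall>X \<in> sym_mats_on V.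
        hadamard A X = 0 \<and> hadamard (mat 1) X = 0 \<and> del_row i (A ** X) = 0 \<longrightarrow> X = 0)"

definition xixi :: "'v::finite pair_pre_digraph \<Rightarrow> 'v \<Rightarrow> nat" where
  "xixi G i = Max {k + l | k l. k \<le> l \<and>
     (\<exists>A \<in> graph_mats G. has_SNIP (pverts G) i A \<and> nullity_pair (pverts G) i A = (k, l))}"

end

theory Submission
  imports Defs
begin

text \<open>
  Write \<open>A \<in> S(G)\<close> with diagonal blocks \<open>B\<close> on \<open>G\<^sub>1 - i\<close> and \<open>C\<close> on \<open>G\<^sub>2 - i\<close>. If \<open>u\<close> and \<open>w\<close> are
  nonzero null vectors of \<open>B\<close> and \<open>C\<close>, then \<open>X = u w\<^sup>T + w u\<^sup>T\<close> violates the SNIP. So one block,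
  say \<open>C\<close>, is nonsingular, and taking the Schur complement of \<open>C\<close> only changes the diagonal entry
  at \<open>i\<close> of the part of \<open>A\<close> on \<open>G\<^sub>1\<close>. The Schur complement has the same nullity pair as \<open>A\<close>, and
  it has the SNIP iff \<open>A\<close> does. Conversely, every matrix in \<open>S(G\<^sub>1)\<close> is such a Schur complement,
  with a diagonally dominant \<open>C\<close>. So the nullity pairs attained by SNIP matrices for \<open>G\<close> are
  exactly those attained for \<open>G\<^sub>1\<close> or \<open>G\<^sub>2\<close>.
\<close>

section \<open>Nonsingular principal blocks\<close>

text \<open>Principal blocks are tested on vectors extended by zero, so no submatrix has to be
  formed; entries of \<open>A *v x\<close> outside \<open>W\<close> are ignored.\<close>

definition nonsingular_on :: "'v set \<Rightarrow> real ^ 'v ^ 'v::finite \<Rightarrow> bool" where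
  "nonsingular_on W A \<longleftrightarrow> (\<forall>x \<in> vecs_on W. (\<forall>p \<in> W. (A *v x) $ p = 0) \<longrightarrow> x = 0)"

lemma nonsingular_on_solve:
  fixes A :: "real ^ 'v ^ 'v::finite"
  assumes "nonsingular_on W A"
  obtains y where "y \<in> vecs_on W" and "\<And>p. p \<in> W \<Longrightarrow> (A *v y) $ p = c $ p"
proof -
  \<comment> \<open>Rows outside \<open>W\<close> become unit rows. This makes the system square
    over all labels, with trivial kernel, so injectivity gives solvability.\<close>
  define N where "N = (\<chi> p. if p \<in> W then A $ p else axis p 1)"
  have N: "(N *v x) $ p = (if p \<in> W then (A *v x) $ p else x $ p)" for x p
    by (simp add: N_def matrix_vector_mul_component inner_axis')
  have "inj ((*v) N)"
  proof (subst linear_injective_0; (intro allI impI)?)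
    fix x assume x: "N *v x = 0"
    have *: "p \<in> W \<Longrightarrow> (A *v x) $ p = 0" "p \<notin> W \<Longrightarrow> x $ p = 0" for p
      using N[of x p] x by auto
    have "x \<in> vecs_on W" and "\<forall>p\<in>W. (A *v x) $ p = 0"
      using * by (auto simp: vecs_on_def)
    then show "x = 0"
      using assms unfolding nonsingular_on_def by blast
  qed simp
  then have "surj ((*v) N)"
    by (intro linear_injective_imp_surjective) auto
  then obtain y where y: "N *v y = (\<chi> p. if p \<in> W then c $ p else 0)"
    by (metis surjD)
  have "p \<in> W \<Longrightarrow> (A *v y) $ p = c $ p" "p \<notin> W \<Longrightarrow> y $ p = 0" for p
    using N[of y p] y by auto
  then show thesis
    by (intro that[of y]) (auto simp: vecs_on_def)
qed

text \<open>Let p be an index where |x| is largest. If p lies in \<open>W\<close>, row p of the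
  equation gives (n + 1)|x_p| \<le> n|x_p| with n = \<open>CARD('v)\<close>, hence x_p = 0.\<close>

lemma diagonally_dominant_nonsingular_on:
  fixes A :: "real ^ 'v ^ 'v::finite"
  assumes diag: "\<And>p. p \<in> W \<Longrightarrow> A $ p $ p = real CARD('v) + 1"
    and off: "\<And>p q. p \<in> W \<Longrightarrow> q \<in> W \<Longrightarrow> p \<noteq> q \<Longrightarrow> \<bar>A $ p $ q\<bar> \<le> 1"
  shows "nonsingular_on W A"
  unfolding nonsingular_on_def
proof (intro ballI impI)
  fix x assume x: "x \<in> vecs_on W" and Ax: "\<forall>p\<in>W. (A *v x) $ p = 0"
  obtain p where p: "\<And>q. \<bar>x $ q\<bar> \<le> \<bar>x $ p\<bar>"
  proof -
    have "Max (range (\<lambda>q. \<bar>x $ q\<bar>)) \<in> range (\<lambda>q. \<bar>x $ q\<bar>)"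
      by (intro Max_in) auto
    then obtain p where "Max (range (\<lambda>q. \<bar>x $ q\<bar>)) = \<bar>x $ p\<bar>"
      by (rule imageE)
    then show thesis
      by (intro that[of p]) (metis Max_ge finite finite_imageI rangeI)
  qed
  have "x $ p = 0"
  proof (cases "p \<in> W")
    case True
    have "0 = (\<Sum>q\<in>UNIV. A $ p $ q * x $ q)"
      using Ax True by (simp add: matrix_vector_mult_def)
    also have "\<dots> = A $ p $ p * x $ p + (\<Sum>q\<in>UNIV - {p}. A $ p $ q * x $ q)"
      by (simp add: sum.remove[of UNIV p])
    finally have "(real CARD('v) + 1) * x $ p = - (\<Sum>q\<in>UNIV - {p}. A $ p $ q * x $ q)"
      using diag[OF True] by simp
    then have "\<bar>(real CARD('v) + 1) * x $ p\<bar> = \<bar>\<Sum>q\<in>UNIV - {p}. A $ p $ q * x $ q\<bar>"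
      by simp
    then have "(real CARD('v) + 1) * \<bar>x $ p\<bar> = \<bar>\<Sum>q\<in>UNIV - {p}. A $ p $ q * x $ q\<bar>"
      by (simp add: abs_mult)
    also have "\<dots> \<le> (\<Sum>q\<in>UNIV - {p}. \<bar>x $ p\<bar>)"
    proof (rule order.trans[OF sum_abs sum_mono])
      fix q assume q: "q \<in> UNIV - {p}"
      show "\<bar>A $ p $ q * x $ q\<bar> \<le> \<bar>x $ p\<bar>"
      proof (cases "q \<in> W")
        case True
        then have "\<bar>A $ p $ q\<bar> * \<bar>x $ q\<bar> \<le> 1 * \<bar>x $ p\<bar>"
          using off[OF \<open>p \<in> W\<close> True] q p[of q] by (intro mult_mono) auto
        then show ?thesis by (simp add: abs_mult)
      qed (use x in \<open>auto simp: vecs_on_def\<close>)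
    qed
    also have "\<dots> \<le> real CARD('v) * \<bar>x $ p\<bar>"
      by (simp add: card_Diff_singleton mult_right_mono)
    finally show ?thesis by (simp add: algebra_simps)
  qed (use x in \<open>auto simp: vecs_on_def\<close>)
  then show "x = 0"
    using p by (auto simp: vec_eq_iff)
qed

section \<open>The SNIP in terms of entries and columns\<close>

text \<open>The matrix equation is split into columns so that statements about single vectors, such
  as those on kernels and lifts below, apply to each column of \<open>X\<close>.\<close>

lemma has_SNIP_iff:
  fixes A :: "real ^ 'a ^ 'a::finite"
  shows "has_SNIP V i A \<longleftrightarrow> A \<in> sym_mats_on V \<and>
    (\<forall>X \<in> sym_mats_on V. (\<forall>p q. A $ p $ q * X $ p $ q = 0) \<and> (\<forall>p. X $ p $ p = 0) \<and>
      (\<forall>p q. p \<noteq> i \<longrightarrow> (A *v column q X) $ p = 0) \<longrightarrow> X = 0)"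
proof -
  have 1: "hadamard A X = 0 \<longleftrightarrow> (\<forall>p q. A $ p $ q * X $ p $ q = 0)" for X
    by (simp add: hadamard_def vec_eq_iff)
  have 2: "hadamard (mat 1) X = 0 \<longleftrightarrow> (\<forall>p. X $ p $ p = 0)" for X :: "real ^ 'a ^ 'a"
    by (auto simp: hadamard_def vec_eq_iff mat_def)
  have 3: "del_row i (A ** X) = 0 \<longleftrightarrow> (\<forall>p q. p \<noteq> i \<longrightarrow> (A *v column q X) $ p = 0)"
    for X
    by (auto simp: del_row_def vec_eq_iff matrix_matrix_mult_def matrix_vector_mult_def column_def)
  show ?thesis
    unfolding has_SNIP_def 1 2 3 by (rule refl)
qed

lemma has_SNIP_imp_eq_0:
  assumes "has_SNIP V i A" and "X \<in> sym_mats_on V"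
    and "\<And>p q. A $ p $ q * X $ p $ q = 0" and "\<And>p. X $ p $ p = 0"
    and "\<And>p q. p \<noteq> i \<Longrightarrow> (A *v column q X) $ p = 0"
  shows "X = 0"
  using assms unfolding has_SNIP_iff by blast

lemma sym_mats_on_iff:
  "A \<in> sym_mats_on V \<longleftrightarrow>
    (\<forall>p q. p \<notin> V \<longrightarrow> A $ p $ q = 0) \<and> (\<forall>p q. A $ p $ q = A $ q $ p)"
  by (auto simp: sym_mats_on_def mats_on_def vec_eq_iff transpose_def) metis+

section \<open>Matrices with a cut vertex\<close>

locale cut_vertex_matrix =
  fixes V1 V2 :: "'v::finite set" and i :: 'v and A :: "real ^ 'v ^ 'v"
  assumes inter: "V1 \<inter> V2 = {i}"
    and sym_mat: "A \<in> sym_mats_on (V1 \<union> V2)"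
    and cut: "\<And>p q. p \<in> V1 - {i} \<Longrightarrow> q \<in> V2 - {i} \<Longrightarrow> A $ p $ q = 0"
begin

lemma sym: "A $ p $ q = A $ q $ p"
  using sym_mat by (auto simp: sym_mats_on_iff)

lemma outside: "p \<notin> V1 \<Longrightarrow> p \<notin> V2 \<Longrightarrow> A $ p $ q = 0" "p \<notin> V1 \<Longrightarrow> p \<notin> V2 \<Longrightarrow> A $ q $ p = 0"
  using sym_mat by (auto simp: sym_mats_on_iff)

lemma cut': "p \<in> V2 \<Longrightarrow> p \<noteq> i \<Longrightarrow> q \<in> V1 \<Longrightarrow> q \<noteq> i \<Longrightarrow> A $ p $ q = 0"
  using cut[of q p] sym[of p q] by auto

lemma root: "i \<in> V1" "i \<in> V2"
  using inter by auto

lemma only_root: "p \<in> V1 \<Longrightarrow> p \<in> V2 \<Longrightarrow> p = i"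
  using inter by auto

lemma swap: "cut_vertex_matrix V2 V1 i A"
  using inter sym_mat cut' by unfold_locales (auto simp: Un_commute)

lemma mult_cut:
  assumes "x \<in> vecs_on (V2 - {i})" and "p \<in> V1 - {i}"
  shows "(A *v x) $ p = 0"
  unfolding matrix_vector_mult_def vec_lambda_beta
proof (rule sum.neutral, rule ballI)
  fix q
  show "A $ p $ q * x $ q = 0"
    using assms cut[of p q] by (cases "q \<in> V2 - {i}") (auto simp: vecs_on_def)
qed

lemma SNIP_imp_nonsingular_block:
  assumes "has_SNIP (V1 \<union> V2) i A"
  shows "nonsingular_on (V1 - {i}) A \<or> nonsingular_on (V2 - {i}) A"
proof (rule ccontr)
  assume "\<not> ?thesis"
  then obtain u w where u: "u \<in> vecs_on (V1 - {i})" "\<And>p. p \<in> V1 - {i} \<Longrightarrow> (A *v u) $ p = 0" "u \<noteq> 0"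
    and w: "w \<in> vecs_on (V2 - {i})" "\<And>p. p \<in> V2 - {i} \<Longrightarrow> (A *v w) $ p = 0" "w \<noteq> 0"
    unfolding nonsingular_on_def by blast
  interpret sw: cut_vertex_matrix V2 V1 i A by (rule swap)
  \<comment> \<open>Each of \<open>u\<close> and \<open>w\<close> is annihilated on its own side by
    choice and on the other side because of the cut; only row \<open>i\<close> remains
    uncontrolled.\<close>
  have zero: "(A *v u) $ p = 0" "(A *v w) $ p = 0" if np: "p \<noteq> i" for p
  proof -
    consider "p \<in> V1 - {i}" | "p \<in> V2 - {i}" | "p \<notin> V1 \<union> V2" using np by blast
    then have "(A *v u) $ p = 0 \<and> (A *v w) $ p = 0"
      by cases (use u w mult_cut sw.mult_cut in \<open>auto simp: matrix_vector_mult_def outside\<close>)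
    then show "(A *v u) $ p = 0" "(A *v w) $ p = 0" by auto
  qed
  have u0: "u $ p = 0" if "p \<notin> V1 - {i}" for p using u(1) that by (auto simp: vecs_on_def)
  have w0: "w $ p = 0" if "p \<notin> V2 - {i}" for p using w(1) that by (auto simp: vecs_on_def)
  \<comment> \<open>\<open>X\<close> lives on the two cross blocks, where \<open>A\<close> is zero,
    and its columns are combinations of \<open>u\<close> and \<open>w\<close>.\<close>
  define X where "X = (\<chi> p q. u $ p * w $ q + w $ p * u $ q)"
  have col: "column q X = w $ q *\<^sub>R u + u $ q *\<^sub>R w" for q
    by (simp add: column_def X_def vec_eq_iff)
  have "X = 0"
  proof (rule has_SNIP_imp_eq_0[OF assms])
    show "X \<in> sym_mats_on (V1 \<union> V2)"
      using u0 w0 by (auto simp: sym_mats_on_iff X_def)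
    show "A $ p $ q * X $ p $ q = 0" for p q
    proof (cases "A $ p $ q = 0")
      case False
      then have "p \<notin> V1 - {i} \<or> q \<notin> V2 - {i}" "p \<notin> V2 - {i} \<or> q \<notin> V1 - {i}"
        using cut[of p q] cut[of q p] sym[of p q] by auto
      then show ?thesis
        using u0[of p] u0[of q] w0[of p] w0[of q] by (auto simp: X_def)
    qed simp
    show "X $ p $ p = 0" for p
      using u0[of p] w0[of p] only_root[of p] by (auto simp: X_def)
    show "(A *v column q X) $ p = 0" if "p \<noteq> i" for p q
      using zero[OF that] by (simp add: col matrix_vector_right_distrib matrix_vector_mult_scaleR)
  qed
  moreover obtain p q where pq: "u $ p \<noteq> 0" "w $ q \<noteq> 0"
    using u(3) w(3) by (auto simp: vec_eq_iff)
  moreover have "u $ q = 0"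
    using pq u0[of q] w0[of q] only_root[of q] by auto
  moreover have "X $ p $ q = u $ p * w $ q + w $ p * u $ q"
    by (simp add: X_def)
  ultimately show False by simp
qed

end

section \<open>Schur complement of the block on \<open>V2 - {i}\<close>\<close>

definition schur_at :: "'v set \<Rightarrow> 'v \<Rightarrow> real ^ 'v \<Rightarrow> real ^ 'v ^ 'v::finite \<Rightarrow> real ^ 'v ^ 'v" where
  "schur_at V1 i y A = (\<chi> p q. if p \<in> V1 \<and> q \<in> V1
     then A $ p $ q - (if p = i \<and> q = i then (A *v y) $ i else 0) else 0)"

text \<open>
  With \<open>c\<close> the part of column \<open>i\<close> of \<open>A\<close> indexed by \<open>V2 - {i}\<close> and \<open>C\<close> the corresponding
  principal block, \<open>y\<close> is \<open>C\<^sup>-\<^sup>1 c\<close>, so that \<open>(A *v y) $ i\<close> is \<open>c\<^sup>T C\<^sup>-\<^sup>1 c\<close>.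
\<close>

locale schur_cut = cut_vertex_matrix +
  fixes y :: "real ^ 'a"
  assumes ns: "nonsingular_on (V2 - {i}) A"
    and y_on: "y \<in> vecs_on (V2 - {i})"
    and Ay: "\<And>p. p \<in> V2 - {i} \<Longrightarrow> (A *v y) $ p = A $ p $ i"
begin

abbreviation "S \<equiv> schur_at V1 i y A"

text \<open>Block elimination: a vector on \<open>V1\<close> is continued to \<open>V2 - {i}\<close>
  by - x_i C^{-1} c, the only continuation for which \<open>A\<close> gives zero in the rows of
  \<open>V2 - {i}\<close>.\<close>

definition lift :: "real ^ 'a \<Rightarrow> real ^ 'a" where
  "lift x = x - x $ i *\<^sub>R y"

lemma y0: "p \<notin> V2 \<Longrightarrow> y $ p = 0" "p \<in> V1 \<Longrightarrow> y $ p = 0" "y $ i = 0"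
  using y_on only_root[of p] by (auto simp: vecs_on_def)

lemma linear_lift: "linear lift"
  by (rule linearI) (auto simp: lift_def algebra_simps)

lemma lift_in: "x \<in> vecs_on V1 \<Longrightarrow> lift x \<in> vecs_on (V1 \<union> V2)"
  using root y0 by (auto simp: lift_def vecs_on_def)

lemma lift_nth: "p \<in> V1 \<Longrightarrow> lift x $ p = x $ p"
  using y0 by (simp add: lift_def)

text \<open>In rows of \<open>V2 - {i}\<close> the contribution of column \<open>i\<close> cancels
  against that of \<open>y\<close>. In row \<open>i\<close> the term in \<open>y\<close> is the
  correction to the diagonal entry of \<open>S\<close>, and in rows of \<open>V1 - {i}\<close> the
  cut makes that term vanish.\<close>

lemma mult_lift:
  assumes "x \<in> vecs_on V1"
  shows "A *v lift x = S *v x"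
proof (subst vec_eq_iff, rule allI)
  fix p
  have x0: "x $ q = 0" if "q \<notin> V1" for q using assms that by (auto simp: vecs_on_def)
  have L: "(A *v lift x) $ p = (\<Sum>q\<in>UNIV. A $ p $ q * x $ q) - x $ i * (A *v y) $ p"
    by (simp add: lift_def matrix_vector_mult_diff_distrib matrix_vector_mult_scaleR
        matrix_vector_mult_def[of A x])
  have R: "(S *v x) $ p = (\<Sum>q\<in>UNIV. S $ p $ q * x $ q)"
    by (simp add: matrix_vector_mult_def)
  consider "p = i" | "p \<in> V1" "p \<noteq> i" | "p \<in> V2" "p \<notin> V1" "p \<noteq> i" | "p \<notin> V1" "p \<notin> V2"
    using root by blast
  then show "(A *v lift x) $ p = (S *v x) $ p"
  proof cases
    case 1
    have "S $ p $ q * x $ q = A $ p $ q * x $ q - (if q = i then x $ i * (A *v y) $ i else 0)" for q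
      using 1 x0[of q] root by (auto simp: schur_at_def algebra_simps)
    then show ?thesis
      unfolding L R by (simp add: sum_subtractf 1)
  next
    case 2
    have "(\<Sum>q\<in>UNIV. S $ p $ q * x $ q) = (\<Sum>q\<in>UNIV. A $ p $ q * x $ q)"
      by (rule sum.cong) (use 2 x0 in \<open>auto simp: schur_at_def\<close>)
    then show ?thesis
      unfolding L R using mult_cut[OF y_on, of p] 2 by simp
  next
    case 3
    have "(\<Sum>q\<in>UNIV. A $ p $ q * x $ q) = (\<Sum>q\<in>UNIV. if q = i then A $ p $ i * x $ i else 0)"
      by (intro sum.cong refl) (use 3 x0 cut' in auto)
    moreover have "S $ p $ q = 0" for q using 3 by (simp add: schur_at_def)
    ultimately show ?thesis
      unfolding L R using Ay[of p] 3 by simp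
  next
    case 4
    then show ?thesis
      by (auto simp: matrix_vector_mult_def outside schur_at_def)
  qed
qed

text \<open>The difference between \<open>x\<close> and the lift of its restriction is supported on
  \<open>V2 - {i}\<close> and is annihilated in those rows, so nonsingularity of the block makes it
  zero.\<close>

lemma eq_lift:
  assumes "x \<in> vecs_on (V1 \<union> V2)" and "\<And>p. p \<in> V2 - {i} \<Longrightarrow> (A *v x) $ p = 0"
  shows "x = lift (\<chi> p. if p \<in> V1 then x $ p else 0)"
proof -
  define x1 where "x1 = (\<chi> p. if p \<in> V1 then x $ p else 0)"
  have x1: "x1 \<in> vecs_on V1" by (simp add: x1_def vecs_on_def)
  have "x - lift x1 \<in> vecs_on (V2 - {i})"
    using assms(1) root y0 by (auto simp: vecs_on_def lift_def x1_def)
  moreover have "(A *v (x - lift x1)) $ p = 0" if "p \<in> V2 - {i}" for p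
  proof -
    have "p \<notin> V1" using that only_root by auto
    then have "(S *v x1) $ p = 0"
      by (simp add: matrix_vector_mult_def schur_at_def)
    then show ?thesis
      using assms(2)[OF that] mult_lift[OF x1] by (simp add: matrix_vector_mult_diff_distrib)
  qed
  ultimately have "x - lift x1 = 0"
    using ns unfolding nonsingular_on_def by blast
  then show ?thesis by (simp add: x1_def)
qed

section \<open>Nullities of the Schur complement\<close>

text \<open>\<open>lift\<close> is injective on vectors on \<open>V1\<close> and maps the kernel of
  \<open>S\<close> onto the kernel of \<open>A\<close>.\<close>

lemma nullity_schur: "nullity_on (V1 \<union> V2) A = nullity_on V1 S"
proof -
  let ?K = "{x \<in> vecs_on V1. S *v x = 0}"
  have "{x \<in> vecs_on (V1 \<union> V2). A *v x = 0} = lift ` ?K"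
  proof (intro equalityI subsetI)
    fix x assume x: "x \<in> {x \<in> vecs_on (V1 \<union> V2). A *v x = 0}"
    let ?x = "\<chi> p. if p \<in> V1 then x $ p else 0"
    have eq: "x = lift ?x" using x by (intro eq_lift) auto
    have x1: "?x \<in> vecs_on V1" by (simp add: vecs_on_def)
    have "S *v ?x = 0" using mult_lift[OF x1, folded eq] x by simp
    then show "x \<in> lift ` ?K"
      using x1 by (subst eq) (intro imageI, simp)
  qed (auto simp: mult_lift lift_in)
  moreover have "inj_on lift (span ?K)"
  proof (rule inj_on_subset)
    have "subspace (vecs_on V1 :: (real ^ 'a) set)"
      by (auto simp: subspace_def vecs_on_def)
    then show "span ?K \<subseteq> vecs_on V1"
      by (intro span_minimal) auto
    show "inj_on lift (vecs_on V1)"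
    proof (rule inj_onI, subst vec_eq_iff, rule allI)
      fix a b p assume "a \<in> vecs_on V1" "b \<in> vecs_on V1" "lift a = lift b"
      then show "a $ p = b $ p"
        using lift_nth[of p a] lift_nth[of p b] by (cases "p \<in> V1") (auto simp: vecs_on_def)
    qed
  qed
  ultimately show ?thesis
    by (simp add: nullity_on_def dim_image_eq[OF linear_lift])
qed

text \<open>A vector with zero entry at \<open>i\<close> is its own lift, so the two kernels are
  even equal as sets.\<close>

lemma nullity_del_schur:
  "nullity_on (V1 \<union> V2 - {i}) (del_row_col i A) = nullity_on (V1 - {i}) (del_row_col i S)"
proof -
  have del: "(del_row_col i M *v x) $ p = (if p = i then 0 else (M *v x) $ p)"
    if "x $ i = 0" for M :: "real ^ 'a ^ 'a" and x p
  proof -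
    have "del_row_col i M $ p $ q * x $ q = (if p = i then 0 else M $ p $ q * x $ q)" for q
      using that by (auto simp: del_row_col_def)
    then show ?thesis by (simp add: matrix_vector_mult_def)
  qed
  have del0: "del_row_col i M *v x = 0 \<longleftrightarrow> (\<forall>p. p \<noteq> i \<longrightarrow> (M *v x) $ p = 0)"
    if "x $ i = 0" for M :: "real ^ 'a ^ 'a" and x
    using del[OF that] by (auto simp: vec_eq_iff)
  have "{x \<in> vecs_on (V1 \<union> V2 - {i}). del_row_col i A *v x = 0} =
        {x \<in> vecs_on (V1 - {i}). del_row_col i S *v x = 0}"
  proof (intro equalityI subsetI)
    fix x assume x: "x \<in> {x \<in> vecs_on (V1 \<union> V2 - {i}). del_row_col i A *v x = 0}"
    let ?x = "\<chi> p. if p \<in> V1 then x $ p else 0"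
    have xi: "x $ i = 0" and xV: "x \<in> vecs_on (V1 \<union> V2)" using x by (auto simp: vecs_on_def)
    have Ax: "(A *v x) $ p = 0" if "p \<noteq> i" for p
      using x that del0[OF xi] by auto
    have "x = lift ?x"
      by (rule eq_lift[OF xV]) (use Ax in auto)
    also have "lift ?x = ?x" using xi root by (simp add: lift_def)
    finally have eq: "x = ?x" .
    have x1: "x \<in> vecs_on V1"
      by (subst eq) (simp add: vecs_on_def)
    have "lift x = x" using xi by (simp add: lift_def)
    then have "A *v x = S *v x" using mult_lift[OF x1] by simp
    then show "x \<in> {x \<in> vecs_on (V1 - {i}). del_row_col i S *v x = 0}"
      using x1 xi Ax del0[OF xi, of S] by (auto simp: vecs_on_def)
  next
    fix x assume x: "x \<in> {x \<in> vecs_on (V1 - {i}). del_row_col i S *v x = 0}"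
    have xi: "x $ i = 0" and x1: "x \<in> vecs_on V1" using x by (auto simp: vecs_on_def)
    have "lift x = x" using xi by (simp add: lift_def)
    then have "A *v x = S *v x" using mult_lift[OF x1] by simp
    then show "x \<in> {x \<in> vecs_on (V1 \<union> V2 - {i}). del_row_col i A *v x = 0}"
      using x del0[OF xi] by (auto simp: vecs_on_def)
  qed
  then show ?thesis by (simp add: nullity_on_def)
qed

lemma nullity_pair_schur: "nullity_pair (V1 \<union> V2) i A = nullity_pair V1 i S"
  by (simp add: nullity_pair_def nullity_schur nullity_del_schur)

lemma schur_sym: "S \<in> sym_mats_on V1"
  using sym by (auto simp: sym_mats_on_iff schur_at_def)

section \<open>SNIP of the Schur complement\<close>

text \<open>Every column of \<open>X\<close> is a lift, so \<open>X\<close> is determined by its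
  rows in \<open>V1\<close>. Its restriction to \<open>V1\<close> satisfies the SNIP conditions for
  \<open>S\<close>, which differs from \<open>A\<close> there only at the entry (i, i), where
  \<open>X\<close> is zero.\<close>

lemma SNIP_schur_imp:
  assumes "has_SNIP V1 i S"
  shows "has_SNIP (V1 \<union> V2) i A"
  unfolding has_SNIP_iff
proof (intro conjI ballI impI)
  fix X assume X: "X \<in> sym_mats_on (V1 \<union> V2)"
    and *: "(\<forall>p q. A $ p $ q * X $ p $ q = 0) \<and> (\<forall>p. X $ p $ p = 0) \<and>
      (\<forall>p q. p \<noteq> i \<longrightarrow> (A *v column q X) $ p = 0)"
  let ?c = "\<lambda>q. \<chi> p. if p \<in> V1 then X $ p $ q else 0"
  have Xs: "X $ p $ q = X $ q $ p" and X0: "p \<notin> V1 \<union> V2 \<Longrightarrow> X $ p $ q = 0" for p q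
    using X by (auto simp: sym_mats_on_iff)
  have col: "column q X = lift (?c q)" for q
  proof -
    have "column q X \<in> vecs_on (V1 \<union> V2)" using X0 by (auto simp: vecs_on_def column_def)
    then have "column q X = lift (\<chi> p. if p \<in> V1 then column q X $ p else 0)"
      by (rule eq_lift) (use * in auto)
    also have "(\<chi> p. if p \<in> V1 then column q X $ p else 0) = ?c q"
      by (simp add: column_def vec_eq_iff)
    finally show ?thesis .
  qed
  have ent: "X $ p $ q = - X $ i $ q * y $ p" if "p \<notin> V1" for p q
    using arg_cong[OF col[of q], of "\<lambda>v. v $ p"] that root by (simp add: lift_def column_def)
  define X1 where "X1 = (\<chi> p q. if p \<in> V1 \<and> q \<in> V1 then X $ p $ q else 0)"
  have "X1 = 0"
  proof (rule has_SNIP_imp_eq_0[OF assms])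
    show "X1 \<in> sym_mats_on V1" using Xs by (auto simp: sym_mats_on_iff X1_def)
    show "S $ p $ q * X1 $ p $ q = 0" for p q
      using * by (auto simp: X1_def schur_at_def)
    show "X1 $ p $ p = 0" for p using * by (simp add: X1_def)
    show "(S *v column q X1) $ p = 0" if "p \<noteq> i" for p q
    proof (cases "q \<in> V1")
      case True
      then have "column q X1 = ?c q" by (simp add: column_def X1_def vec_eq_iff)
      moreover have "S *v ?c q = A *v column q X"
        unfolding col by (rule mult_lift[symmetric]) (simp add: vecs_on_def)
      ultimately show ?thesis using * that by simp
    next
      case False
      then have "column q X1 = 0" by (simp add: column_def X1_def vec_eq_iff)
      then show ?thesis by simp
    qed
  qed
  then have "X1 $ p $ q = 0" for p q by simp
  then have in1: "X $ p $ q = 0" if "p \<in> V1" "q \<in> V1" for p q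
    using that by (simp add: X1_def) metis
  \<comment> \<open>For \<open>q\<close> outside \<open>V1\<close>, the lift formula gives X_qi = -
    X_ii y_q = 0, and symmetry turns this into a statement about row \<open>i\<close>.\<close>
  have "X $ i $ q = 0" for q
  proof (cases "q \<in> V1")
    case False
    then have "X $ q $ i = 0" using ent[of q i] * by simp
    then show ?thesis using Xs by simp
  qed (use in1 root in auto)
  then have out: "X $ p $ q = 0" if "p \<notin> V1" for p q
    using ent[OF that] by simp
  have "X $ p $ q = 0" for p q
    using in1[of p q] out[of p q] out[of q p] Xs[of p q] by (cases "p \<in> V1"; cases "q \<in> V1") auto
  then show "X = 0" by (simp add: vec_eq_iff)
qed (rule sym_mat)

text \<open>A test matrix for \<open>S\<close> is extended to one for \<open>A\<close> by lifting
  both its rows and its columns; the extension agrees with it on \<open>V1\<close>.\<close>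

lemma SNIP_imp_schur:
  assumes "has_SNIP (V1 \<union> V2) i A"
  shows "has_SNIP V1 i S"
  unfolding has_SNIP_iff
proof (intro conjI ballI impI)
  fix X assume X: "X \<in> sym_mats_on V1"
    and *: "(\<forall>p q. S $ p $ q * X $ p $ q = 0) \<and> (\<forall>p. X $ p $ p = 0) \<and>
      (\<forall>p q. p \<noteq> i \<longrightarrow> (S *v column q X) $ p = 0)"
  have Xs: "X $ p $ q = X $ q $ p" and X0: "p \<notin> V1 \<Longrightarrow> X $ p $ q = 0" "p \<notin> V1 \<Longrightarrow> X $ q $ p = 0"
    for p q
    using X by (auto simp: sym_mats_on_iff)
  \<comment> \<open>This is P X P^T for the matrix P = I - y e_i^T of \<open>lift\<close>; the term
    X_ii y y^T is absent because \<open>X\<close> has zero diagonal.\<close>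
  define Z where "Z = (\<chi> p q. X $ p $ q - y $ p * X $ i $ q - X $ p $ i * y $ q)"
  have col: "column q Z = lift (column q X) - y $ q *\<^sub>R lift (column i X)" for q
    using * by (simp add: vec_eq_iff column_def Z_def lift_def)
  have cin: "column q X \<in> vecs_on V1" for q using X0 by (simp add: column_def vecs_on_def)
  have "Z = 0"
  proof (rule has_SNIP_imp_eq_0[OF assms])
    show "Z \<in> sym_mats_on (V1 \<union> V2)"
      using Xs X0 y0 by (auto simp: sym_mats_on_iff Z_def)
    show "A $ p $ q * Z $ p $ q = 0" for p q
    proof -
      \<comment> \<open>Outside the block on \<open>V1\<close>, \<open>Z\<close> can be nonzero only
        between \<open>V1 - {i}\<close> and \<open>V2 - {i}\<close>, where \<open>A\<close> is zero
        by the cut.\<close>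
      consider "p \<in> V1" "q \<in> V1" | "p \<notin> V1" "q \<notin> V1" | "p = i" "q \<notin> V1" | "q = i" "p \<notin> V1"
        | "p \<in> V1 - {i}" "q \<in> V2 - {i}" | "q \<in> V1 - {i}" "p \<in> V2 - {i}"
        | "p \<notin> V1 \<union> V2" | "q \<notin> V1 \<union> V2" using root by blast
      then show ?thesis
      proof cases
        case 1
        have "S $ p $ q * X $ p $ q = 0" using * by blast
        then show ?thesis
          using 1 * y0 by (auto simp: Z_def schur_at_def split: if_splits)
      next
        case 3
        then show ?thesis using X0(2)[of q i] * by (simp add: Z_def y0)
      next
        case 4
        then show ?thesis using X0(1)[of p i] * by (simp add: Z_def y0)
      qed (use X0 y0 cut cut' outside in \<open>auto simp: Z_def\<close>)
    qed
    show "Z $ p $ p = 0" for p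
      using * X0[of p] y0(2)[of p] by (cases "p \<in> V1") (auto simp: Z_def)
    show "(A *v column q Z) $ p = 0" if "p \<noteq> i" for p q
      using * that
      by (simp add: col matrix_vector_mult_diff_distrib matrix_vector_mult_scaleR mult_lift[OF cin])
  qed
  then have Z0: "Z $ p $ q = 0" for p q by simp
  have "X $ p $ q = 0" for p q
    using Z0[of p q] X0 y0 by (cases "p \<in> V1 \<and> q \<in> V1") (auto simp: Z_def)
  then show "X = 0" by (simp add: vec_eq_iff)
qed (rule schur_sym)

end

section \<open>Nullity pairs attained with the SNIP\<close>

text \<open>The constraint k \<le> l is left out, so that vertex sums correspond exactly to unions
  of these sets; it returns in \<open>xixi_eq_Max\<close>.\<close>

definition SNIP_pairs :: "'v::finite pair_pre_digraph \<Rightarrow> 'v \<Rightarrow> (nat \<times> nat) set" where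
  "SNIP_pairs G i = {nullity_pair (pverts G) i A | A. A \<in> graph_mats G \<and> has_SNIP (pverts G) i A}"

text \<open>A matrix of \<open>G\<close> all of whose principal blocks are nonsingular. It shows
  that some pair is attained, and it supplies the block C when a matrix is extended to the vertex
  sum.\<close>

definition dominant_mat :: "'v::finite pair_pre_digraph \<Rightarrow> real ^ 'v ^ 'v" where
  "dominant_mat G = (\<chi> p q. if p \<in> pverts G \<and> p = q then real CARD('v) + 1
     else if (p, q) \<in> parcs G then 1 else 0)"

lemma pair_graph_parcs:
  assumes "pair_graph G"
  shows "(p, q) \<in> parcs G \<Longrightarrow> p \<in> pverts G \<and> q \<in> pverts G \<and> p \<noteq> q"
    and "(p, q) \<in> parcs G \<Longrightarrow> (q, p) \<in> parcs G"
proof -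
  interpret pair_graph G by fact
  show "(p, q) \<in> parcs G \<Longrightarrow> p \<in> pverts G \<and> q \<in> pverts G \<and> p \<noteq> q"
    using arc_fst_in_verts[of "(p, q)"] arc_snd_in_verts[of "(p, q)"] no_loops'[of p q] by auto
  show "(p, q) \<in> parcs G \<Longrightarrow> (q, p) \<in> parcs G"
    by (rule arcs_symmetric)
qed

lemma dominant_mat_graph:
  assumes "pair_graph G"
  shows "dominant_mat G \<in> graph_mats G"
  using pair_graph_parcs[OF assms]
  by (auto simp: graph_mats_def sym_mats_on_iff dominant_mat_def)

lemma dominant_mat_nonsingular:
  "W \<subseteq> pverts G \<Longrightarrow> nonsingular_on W (dominant_mat G)"
  by (rule diagonally_dominant_nonsingular_on) (auto simp: dominant_mat_def)

text \<open>This guarantees that the maxima are taken over nonempty sets.\<close>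

lemma zero_in_SNIP_pairs:
  assumes G: "pair_graph G" and i: "i \<in> pverts G"
  shows "(0, 0) \<in> SNIP_pairs G i"
proof -
  let ?A = "dominant_mat G" and ?V = "pverts G"
  have ns: "x = 0" if "W \<subseteq> ?V" "x \<in> vecs_on W" "\<And>p. p \<in> W \<Longrightarrow> (?A *v x) $ p = 0" for W x
    using dominant_mat_nonsingular[OF that(1)] that unfolding nonsingular_on_def by blast
  have "{x \<in> vecs_on ?V. ?A *v x = 0} \<subseteq> {0}"
    using ns[of ?V] by auto
  moreover have "{x \<in> vecs_on (?V - {i}). del_row_col i ?A *v x = 0} \<subseteq> {0}"
  proof
    fix x assume x: "x \<in> {x \<in> vecs_on (?V - {i}). del_row_col i ?A *v x = 0}"
    have "(?A *v x) $ p = 0" if "p \<in> ?V - {i}" for p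
    proof -
      have "x $ i = 0" using x by (simp add: vecs_on_def)
      then have "(?A *v x) $ p = (del_row_col i ?A *v x) $ p"
        unfolding matrix_vector_mult_def vec_lambda_beta
        by (intro sum.cong refl) (use that in \<open>auto simp: del_row_col_def\<close>)
      then show ?thesis using x by simp
    qed
    then show "x \<in> {0}" using ns[of "?V - {i}" x] x by auto
  qed
  ultimately have np: "nullity_pair ?V i ?A = (0, 0)"
    by (simp add: nullity_pair_def nullity_on_def)
  have "has_SNIP ?V i ?A"
    unfolding has_SNIP_iff
  proof (intro conjI ballI impI)
    show "?A \<in> sym_mats_on ?V" using dominant_mat_graph[OF G] by (simp add: graph_mats_def)
    fix X assume X: "X \<in> sym_mats_on ?V"
      and *: "(\<forall>p q. ?A $ p $ q * X $ p $ q = 0) \<and> (\<forall>p. X $ p $ p = 0) \<and>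
        (\<forall>p q. p \<noteq> i \<longrightarrow> (?A *v column q X) $ p = 0)"
    have Xs: "X $ p $ q = X $ q $ p" and X0: "p \<notin> ?V \<Longrightarrow> X $ p $ q = 0" for p q
      using X by (auto simp: sym_mats_on_iff)
    \<comment> \<open>A column with zero entry at \<open>i\<close> is supported on
      \<open>V - {i}\<close>, where the block is nonsingular. Column \<open>i\<close> qualifies by
      the zero diagonal; by symmetry row \<open>i\<close> is then zero, so every column
      qualifies.\<close>
    have col: "column q X = 0" if "X $ i $ q = 0" for q
      by (rule ns[of "?V - {i}"]) (use that * X0 in \<open>auto simp: vecs_on_def column_def\<close>)
    have "column i X = 0" using col * by blast
    then have "X $ i $ q = 0" for q using Xs[of i q] by (simp add: column_def vec_eq_iff)
    then have "column q X = 0" for q using col by blast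
    then show "X = 0" by (simp add: column_def vec_eq_iff)
  qed
  then show ?thesis
    unfolding SNIP_pairs_def using np dominant_mat_graph[OF G] by force
qed

lemma xixi_eq_Max: "xixi G i = Max {k + l | k l. k \<le> l \<and> (k, l) \<in> SNIP_pairs G i}"
proof -
  have "(\<exists>A \<in> graph_mats G. has_SNIP (pverts G) i A \<and> nullity_pair (pverts G) i A = kl) \<longleftrightarrow>
    kl \<in> SNIP_pairs G i" for kl
    unfolding SNIP_pairs_def by blast
  then show ?thesis unfolding xixi_def by (simp only:)
qed

lemma finite_SNIP_sums:
  fixes G :: "'v::finite pair_pre_digraph"
  shows "finite {k + l | k l. k \<le> l \<and> (k, l) \<in> SNIP_pairs G i}"
proof (rule finite_subset)
  have "k \<le> CARD('v) \<and> l \<le> CARD('v)" if "(k, l) \<in> SNIP_pairs G i" for k l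
    using that dim_subset_UNIV[where 'a = "real ^ 'v"]
    by (auto simp: SNIP_pairs_def nullity_pair_def nullity_on_def)
  then show "{k + l | k l. k \<le> l \<and> (k, l) \<in> SNIP_pairs G i} \<subseteq> {..CARD('v) + CARD('v)}"
    by (auto intro: add_mono)
qed simp

section \<open>Vertex sums\<close>

lemma vertex_sum_commute: "vertex_sum G1 G2 = vertex_sum G2 G1"
  by (simp add: vertex_sum_def Un_commute)

context
  fixes G1 G2 :: "'v::finite pair_pre_digraph" and i :: 'v
  assumes G1: "pair_graph G1" and G2: "pair_graph G2"
    and int: "pverts G1 \<inter> pverts G2 = {i}"
begin

text \<open>An arc of \<open>G2\<close> between vertices of \<open>G1\<close> would have both ends
  at \<open>i\<close>, and there are no loops.\<close>

lemma vertex_sum_arc_iff: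
  assumes "p \<in> pverts G1" "q \<in> pverts G1"
  shows "(p, q) \<in> parcs (vertex_sum G1 G2) \<longleftrightarrow> (p, q) \<in> parcs G1"
proof -
  have "(p, q) \<notin> parcs G2"
    using assms int pair_graph_parcs(1)[OF G2, of p q] by (metis IntI singletonD)
  then show ?thesis by (simp add: vertex_sum_def)
qed

lemma vertex_sum_no_cross_arc:
  assumes "p \<in> pverts G1 - {i}" "q \<in> pverts G2 - {i}"
  shows "(p, q) \<notin> parcs (vertex_sum G1 G2)"
  using assms int pair_graph_parcs(1)[OF G1, of p q] pair_graph_parcs(1)[OF G2, of p q]
  by (auto simp: vertex_sum_def)

lemma cut_vertex_matrix_of_vertex_sum:
  assumes "A \<in> graph_mats (vertex_sum G1 G2)"
  shows "cut_vertex_matrix (pverts G1) (pverts G2) i A"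
proof
  show "A \<in> sym_mats_on (pverts G1 \<union> pverts G2)"
    using assms by (simp add: graph_mats_def vertex_sum_def)
  fix p q assume pq: "p \<in> pverts G1 - {i}" "q \<in> pverts G2 - {i}"
  then have "p \<noteq> q" using int by auto
  then show "A $ p $ q = 0"
    using assms pq vertex_sum_no_cross_arc[OF pq] by (auto simp: graph_mats_def vertex_sum_def)
qed (rule int)

text \<open>The Schur complement changes no off-diagonal entry on \<open>G1\<close>, so it is a
  matrix of \<open>G1\<close>; it inherits the nullity pair and the SNIP.\<close>

lemma SNIP_pair_of_nonsingular_block:
  assumes A: "A \<in> graph_mats (vertex_sum G1 G2)"
    and snip: "has_SNIP (pverts G1 \<union> pverts G2) i A"
    and ns: "nonsingular_on (pverts G2 - {i}) A"
  shows "nullity_pair (pverts G1 \<union> pverts G2) i A \<in> SNIP_pairs G1 i"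
proof -
  interpret cut_vertex_matrix "pverts G1" "pverts G2" i A
    by (rule cut_vertex_matrix_of_vertex_sum[OF A])
  obtain y where y: "y \<in> vecs_on (pverts G2 - {i})"
    "\<And>p. p \<in> pverts G2 - {i} \<Longrightarrow> (A *v y) $ p = column i A $ p"
    using nonsingular_on_solve[OF ns, of "column i A"] by blast
  interpret schur_cut "pverts G1" "pverts G2" i A y
    by unfold_locales (use ns y in \<open>auto simp: column_def\<close>)
  have "S $ p $ q \<noteq> 0 \<longleftrightarrow> (p, q) \<in> parcs G1"
    if "p \<in> pverts G1" "q \<in> pverts G1" "p \<noteq> q" for p q
  proof -
    have "S $ p $ q = A $ p $ q" using that by (auto simp: schur_at_def)
    then show ?thesis
      using A that vertex_sum_arc_iff[OF that(1,2)] by (auto simp: graph_mats_def vertex_sum_def)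
  qed
  then have "S \<in> graph_mats G1"
    using schur_sym by (auto simp: graph_mats_def)
  then show ?thesis
    unfolding SNIP_pairs_def nullity_pair_schur using SNIP_imp_schur[OF snip] by blast
qed

lemma SNIP_pairs_subset_vertex_sum: "SNIP_pairs G1 i \<subseteq> SNIP_pairs (vertex_sum G1 G2) i"
proof
  fix kl assume "kl \<in> SNIP_pairs G1 i"
  then obtain A1 where A1: "A1 \<in> graph_mats G1" "has_SNIP (pverts G1) i A1"
    and kl: "kl = nullity_pair (pverts G1) i A1"
    by (auto simp: SNIP_pairs_def)
  have i: "i \<in> pverts G1" "i \<in> pverts G2" using int by auto
  have only: "p = i" if "p \<in> pverts G1" "p \<in> pverts G2" for p using that int by auto
  let ?D = "dominant_mat G2" and ?W = "pverts G2 - {i}"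
  have nsD: "nonsingular_on ?W ?D" by (rule dominant_mat_nonsingular) auto
  obtain y where y: "y \<in> vecs_on ?W" "\<And>p. p \<in> ?W \<Longrightarrow> (?D *v y) $ p = column i ?D $ p"
    using nonsingular_on_solve[OF nsD, of "column i ?D"] by blast
  \<comment> \<open>The entry at (i, i) is raised by c^T C^{-1} c, exactly what the Schur complement
    subtracts again, so that \<open>S = A1\<close>.\<close>
  define A where "A = (\<chi> p q. if p = i \<and> q = i then A1 $ i $ i + (?D *v y) $ i
    else if p \<in> pverts G1 \<and> q \<in> pverts G1 then A1 $ p $ q else ?D $ p $ q)"
  have D: "?D \<in> graph_mats G2" by (rule dominant_mat_graph[OF G2])
  have A1s: "A1 $ p $ q = A1 $ q $ p" for p q using A1 by (auto simp: graph_mats_def sym_mats_on_iff)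
  have Ds: "?D $ p $ q = ?D $ q $ p" and D0: "p \<notin> pverts G2 \<Longrightarrow> ?D $ p $ q = 0" for p q
    using D by (auto simp: graph_mats_def sym_mats_on_iff)
  have A_sym: "A \<in> sym_mats_on (pverts G1 \<union> pverts G2)"
    unfolding sym_mats_on_iff using A1s Ds D0 i by (auto simp: A_def)
  have A_arc: "A $ p $ q \<noteq> 0 \<longleftrightarrow> (p, q) \<in> parcs (vertex_sum G1 G2)" if "p \<noteq> q" for p q
  proof (cases "p \<in> pverts G1 \<and> q \<in> pverts G1")
    case True
    then show ?thesis
      using that A1 vertex_sum_arc_iff[of p q] by (auto simp: A_def graph_mats_def)
  next
    case False
    then show ?thesis
      using that i pair_graph_parcs(1)[OF G1, of p q]
      by (auto simp: A_def dominant_mat_def vertex_sum_def)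
  qed
  have A: "A \<in> graph_mats (vertex_sum G1 G2)"
    using A_sym A_arc by (auto simp: graph_mats_def vertex_sum_def)
  \<comment> \<open>On vectors supported on \<open>V2 - {i}\<close>, with \<open>V2\<close> the
    vertex set of \<open>G2\<close>, \<open>A\<close> and the dominant matrix agree in all rows of
    \<open>V2\<close>. Row \<open>i\<close> is included because it supplies the correction
    term.\<close>
  have AD: "(A *v x) $ p = (?D *v x) $ p" if "x \<in> vecs_on ?W" "p \<in> pverts G2" for x p
  proof -
    have "A $ p $ q * x $ q = ?D $ p $ q * x $ q" for q
      using that only[of q] by (cases "q \<in> ?W") (auto simp: A_def vecs_on_def)
    then show ?thesis
      unfolding matrix_vector_mult_def vec_lambda_beta by (rule sum.cong[OF refl])
  qed
  interpret cut_vertex_matrix "pverts G1" "pverts G2" i A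
    by (rule cut_vertex_matrix_of_vertex_sum[OF A])
  interpret schur_cut "pverts G1" "pverts G2" i A y
  proof
    show "nonsingular_on ?W A"
      using nsD AD by (auto simp: nonsingular_on_def)
    show "y \<in> vecs_on ?W" by (rule y)
    show "(A *v y) $ p = A $ p $ i" if "p \<in> ?W" for p
      using that AD[OF y(1)] y(2)[OF that] only[of p] by (auto simp: A_def column_def)
  qed
  have "S = A1"
    using AD[OF y(1) i(2)] A1(1) i
    by (auto simp: vec_eq_iff schur_at_def A_def graph_mats_def sym_mats_on_def mats_on_def)
  then show "kl \<in> SNIP_pairs (vertex_sum G1 G2) i"
    unfolding SNIP_pairs_def mem_Collect_eq kl
    using A SNIP_schur_imp A1(2) nullity_pair_schur
    by (intro exI[of _ A]) (simp add: vertex_sum_def)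
qed

end

text \<open>The preceding results eliminate the block of \<open>G2\<close>; exchanging the two
  graphs covers the case where the block of \<open>G1\<close> is the nonsingular one.\<close>

lemma SNIP_pairs_vertex_sum:
  assumes G1: "pair_graph G1" and G2: "pair_graph G2"
    and int: "pverts G1 \<inter> pverts G2 = {i}"
  shows "SNIP_pairs (vertex_sum G1 G2) i = SNIP_pairs G1 i \<union> SNIP_pairs G2 i"
proof
  have int': "pverts G2 \<inter> pverts G1 = {i}" using int by (simp add: Int_commute)
  show "SNIP_pairs G1 i \<union> SNIP_pairs G2 i \<subseteq> SNIP_pairs (vertex_sum G1 G2) i"
    using SNIP_pairs_subset_vertex_sum[OF G1 G2 int] SNIP_pairs_subset_vertex_sum[OF G2 G1 int']
    by (simp add: vertex_sum_commute[of G2])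
  show "SNIP_pairs (vertex_sum G1 G2) i \<subseteq> SNIP_pairs G1 i \<union> SNIP_pairs G2 i"
  proof
    fix kl assume "kl \<in> SNIP_pairs (vertex_sum G1 G2) i"
    then obtain A where A: "A \<in> graph_mats (vertex_sum G1 G2)"
      and snip: "has_SNIP (pverts G1 \<union> pverts G2) i A"
      and kl: "kl = nullity_pair (pverts G1 \<union> pverts G2) i A"
      by (auto simp: SNIP_pairs_def vertex_sum_def)
    interpret cut_vertex_matrix "pverts G1" "pverts G2" i A
      by (rule cut_vertex_matrix_of_vertex_sum[OF G1 G2 int A])
    from SNIP_imp_nonsingular_block[OF snip] show "kl \<in> SNIP_pairs G1 i \<union> SNIP_pairs G2 i"
    proof
      assume "nonsingular_on (pverts G1 - {i}) A"
      then have "nullity_pair (pverts G2 \<union> pverts G1) i A \<in> SNIP_pairs G2 i"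
        using A snip by (intro SNIP_pair_of_nonsingular_block[OF G2 G1 int'])
          (simp_all add: vertex_sum_commute[of G2] Un_commute)
      then show ?thesis using kl by (simp add: Un_commute)
    next
      assume "nonsingular_on (pverts G2 - {i}) A"
      then show ?thesis
        using SNIP_pair_of_nonsingular_block[OF G1 G2 int A snip] kl by simp
    qed
  qed
qed

theorem theorem5p3:
  fixes G G1 G2 :: "'v::finite pair_pre_digraph" and i :: 'v
  assumes "pair_graph G1" and "pair_graph G2"
    and "Digraph_Component.connected (with_proj G1)"
    and "Digraph_Component.connected (with_proj G2)"
    and "card (pverts G1) \<ge> 2" and "card (pverts G2) \<ge> 2"
    and "pverts G1 \<inter> pverts G2 = {i}"
    and "G = vertex_sum G1 G2"
  shows "xixi G i = max (xixi G1 i) (xixi G2 i)"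
proof -
  let ?T = "\<lambda>H. {k + l | k l. k \<le> l \<and> (k, l) \<in> SNIP_pairs H i}"
  have "i \<in> pverts G1" "i \<in> pverts G2" using assms(7) by auto
  \<comment> \<open>\<open>Max\<close> of a union splits into a maximum of two values only when both
    sets are nonempty.\<close>
  then have ne: "?T G1 \<noteq> {}" "?T G2 \<noteq> {}"
    using zero_in_SNIP_pairs assms(1,2) by blast+
  have "?T G = ?T G1 \<union> ?T G2"
    unfolding assms(8) SNIP_pairs_vertex_sum[OF assms(1,2,7)] by blast
  then show ?thesis
    unfolding xixi_eq_Max using Max_Un[OF finite_SNIP_sums ne(1) finite_SNIP_sums ne(2)] by simp
qed

end
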